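(* Let $n\ge 1$ and let $M\in\mathbb{Z}_2^{n\times n}$ be any matrix. (a) Some entries on the main diagonal of $M$ can be changed (possibly none) so that the resulting matrix is degenerate. (b) Some entries on the main diagonal of $M$ can be changed (possibly none) so that the resulting matrix is non-degenerate.
   Context: $\mathbb{Z}_2=\{0,1\}$ is the field of residues modulo 2, and $\mathbb{Z}_2^{n\times n}$ is the set of $n\times n$ matrices with entries in $\mathbb{Z}_2$. A square matrix over $\mathbb{Z}_2$ is called degenerate if the sum of some non-empty collection of its columns is the zero column; otherwise it is called non-degenerate. *)

theory Defs
  imports "HOL-Library.Z2" "Jordan_Normal_Form.Matrix"
begin

text \<open>
  The field of residues modulo 2 is the type \<^typ>\<open>bit\<close>. A collection of columns is a set
  of column indices, so equal columns at different positions count separately.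
  The notion is meant for square matrices.
\<close>

definition degenerate :: "bit mat \<Rightarrow> bool" where
  "degenerate A \<longleftrightarrow>
    (\<exists>J. J \<subseteq> {..<dim_col A} \<and> J \<noteq> {} \<and>
      finsum_vec TYPE(bit) (dim_row A) (col A) J = 0\<^sub>v (dim_row A))"

abbreviation non_degenerate :: "bit mat \<Rightarrow> bool" where
  "non_degenerate A \<equiv> \<not> degenerate A"

definition eq_off_diagonal :: "bit mat \<Rightarrow> bit mat \<Rightarrow> bool" where
  "eq_off_diagonal A B \<longleftrightarrow>
    dim_row A = dim_row B \<and> dim_col A = dim_col B \<and>
    (\<forall>i<dim_row A. \<forall>j<dim_col A. i \<noteq> j \<longrightarrow> A $$ (i, j) = B $$ (i, j))"

end

theory Submission
  imports Defs
begin

text \<open>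
  A matrix with at least one column is degenerate if all its columns together sum to zero. That is one condition per row,
  and the diagonal entry of a row can always be chosen to satisfy it
  (\<open>exists_diagonal_zero_row_sums\<close>); this gives the degenerate matrix.

  For the non-degenerate matrix, fix the diagonal entries one after the other, keeping every
  leading square block non-degenerate (\<open>exists_diagonal_independent\<close>). Suppose that the block of
  size \<open>k\<close> is non-degenerate and that both values of the next diagonal entry fail, so that
  the non-empty column sets \<open>J\<^sub>0\<close> and \<open>J\<^sub>1\<close> sum to zero in the two blocks of size \<open>Suc k\<close>.
  Both sets contain the new column \<open>k\<close>, since otherwise they would be dependencies of the old block.
  Hence their symmetric difference consists of old columns; modulo 2 it sums to zero in the old
  rows, and so it is empty. But then one and the same set \<open>J\<^sub>0 = J\<^sub>1\<close>, containing \<open>k\<close>, has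
  row sum zero in row \<open>k\<close> for both values of the diagonal entry, which is absurd.
\<close>

definition set_diagonal :: "(nat \<Rightarrow> bit) \<Rightarrow> (nat \<Rightarrow> nat \<Rightarrow> bit) \<Rightarrow> nat \<Rightarrow> nat \<Rightarrow> bit" where
  "set_diagonal d a i j = (if i = j then d i else a i j)"

text \<open>
  Matrices appear here as functions on all pairs of indices, so that the leading blocks of
  different sizes, which the induction compares, come from one and the same function.
\<close>

definition independent_columns :: "nat \<Rightarrow> (nat \<Rightarrow> nat \<Rightarrow> bit) \<Rightarrow> bool" where
  "independent_columns k a \<longleftrightarrow>
    (\<forall>J. J \<subseteq> {..<k} \<longrightarrow> (\<forall>i<k. (\<Sum>j\<in>J. a i j) = 0) \<longrightarrow> J = {})"

lemma degenerate_mat_iff: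
  "degenerate (mat n n (\<lambda>(i, j). a i j)) \<longleftrightarrow> \<not> independent_columns n a"
proof -
  let ?A = "mat n n (\<lambda>(i, j). a i j)"
  have *: "finsum_vec TYPE(bit) n (col ?A) J = 0\<^sub>v n \<longleftrightarrow> (\<forall>i<n. (\<Sum>j\<in>J. a i j) = 0)"
    if J: "J \<subseteq> {..<n}" for J
  proof -
    have fin: "finite J"
      using J finite_subset by blast
    have cols: "col ?A \<in> J \<rightarrow> carrier_vec n"
      by (intro Pi_I carrier_vecI) simp
    have entry: "finsum_vec TYPE(bit) n (col ?A) J $ i = (\<Sum>j\<in>J. a i j)" if "i < n" for i
    proof -
      have "finsum_vec TYPE(bit) n (col ?A) J $ i = (\<Sum>j\<in>J. col ?A j $ i)"
        by (rule index_finsum_vec[OF fin that cols])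
      also have "\<dots> = (\<Sum>j\<in>J. a i j)"
        using J that by (intro sum.cong) auto
      finally show ?thesis .
    qed
    have "finsum_vec TYPE(bit) n (col ?A) J \<in> carrier_vec n"
      by (rule finsum_vec_closed[OF cols])
    then show ?thesis
      using entry by (simp add: vec_eq_iff)
  qed
  show ?thesis
    unfolding degenerate_def independent_columns_def dim_row_mat dim_col_mat
    by (metis *)
qed

lemma eq_off_diagonal_set_diagonal:
  assumes "M \<in> carrier_mat n n"
  shows "eq_off_diagonal M (mat n n (\<lambda>(i, j). set_diagonal d (\<lambda>i j. M $$ (i, j)) i j))"
  using assms unfolding eq_off_diagonal_def set_diagonal_def by auto

lemma exists_diagonal_zero_row_sums:
  "\<exists>d. \<forall>i<n. (\<Sum>j<n. set_diagonal d a i j) = 0"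
proof (intro exI allI impI)
  fix i assume "i < n"
  let ?d = "\<lambda>i. - (\<Sum>j\<in>{..<n} - {i}. a i j)"
  have "(\<Sum>j<n. set_diagonal ?d a i j) = ?d i + (\<Sum>j\<in>{..<n} - {i}. set_diagonal ?d a i j)"
    using \<open>i < n\<close> by (subst sum.remove[of _ i]) (auto simp: set_diagonal_def)
  also have "(\<Sum>j\<in>{..<n} - {i}. set_diagonal ?d a i j) = (\<Sum>j\<in>{..<n} - {i}. a i j)"
    by (intro sum.cong) (auto simp: set_diagonal_def)
  finally show "(\<Sum>j<n. set_diagonal ?d a i j) = 0"
    by simp
qed

text \<open>The sum over the intersection occurs twice on the right and cancels modulo 2.\<close>

lemma sum_bit_sym_diff:
  fixes f :: "'a \<Rightarrow> bit"
  assumes "finite A" "finite B"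
  shows "sum f (sym_diff A B) = sum f A + sum f B"
proof -
  have cancel: "(p + q) + (p + r) = q + r" for p q r :: bit
    by (cases p; cases q; cases r; simp)
  have "sum f (sym_diff A B) = sum f (A - B) + sum f (B - A)"
    using assms by (intro sum.union_disjoint) auto
  also have "\<dots> = (sum f (A \<inter> B) + sum f (A - B)) + (sum f (B \<inter> A) + sum f (B - A))"
    unfolding Int_commute[of B A] by (rule cancel[symmetric])
  also have "\<dots> = sum f A + sum f B"
    using sum.Int_Diff[OF assms(1), of f B] sum.Int_Diff[OF assms(2), of f A] by (simp only:)
  finally show ?thesis .
qed

lemma exists_diagonal_independent:
  "\<exists>d. independent_columns k (set_diagonal d a)"
proof (induction k)
  case 0
  show ?case
    by (simp add: independent_columns_def)
next
  case (Suc k)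
  then obtain d where d: "independent_columns k (set_diagonal d a)"
    by blast
  let ?b = "\<lambda>c. set_diagonal (d(k := c)) a"
  show ?case
  proof (rule ccontr)
    assume "\<not> ?case"
    then have dependent: "\<not> independent_columns (Suc k) (?b c)" for c
      by blast
    \<comment> \<open>The index is the value of the new diagonal entry, so the sets of the idea above
      are \<open>J 0\<close> and \<open>J 1\<close>.\<close>
    obtain J where J: "\<And>c. J c \<subseteq> {..<Suc k}" "\<And>c. J c \<noteq> {}"
      and zero: "\<And>c i. i < Suc k \<Longrightarrow> (\<Sum>j\<in>J c. ?b c i j) = 0"
      using dependent unfolding independent_columns_def by metis
    have fin: "finite (J c)" for c
      using J(1) finite_subset by blast
    have old_row: "?b c i = set_diagonal d a i" if "i < k" for c i
      using that by (auto simp: set_diagonal_def)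
    then have zero_old: "(\<Sum>j\<in>J c. set_diagonal d a i j) = 0" if "i < k" for c i
      using zero[of i c] that by simp
    have new_col: "k \<in> J c" for c
    proof (rule ccontr)
      assume "k \<notin> J c"
      then have "J c \<subseteq> {..<k}"
        using J(1)[of c] by (auto simp: less_Suc_eq)
      then show False
        using d J(2)[of c] zero_old unfolding independent_columns_def by blast
    qed
    have "sym_diff (J 0) (J 1) \<subseteq> {..<k}"
      using J(1)[of 0] J(1)[of 1] new_col[of 0] new_col[of 1] by (auto simp: less_Suc_eq)
    moreover have "(\<Sum>j\<in>sym_diff (J 0) (J 1). set_diagonal d a i j) = 0" if "i < k" for i
      using that by (simp add: sum_bit_sym_diff fin zero_old)
    ultimately have "sym_diff (J 0) (J 1) = {}"
      using d unfolding independent_columns_def by blast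
    then have same: "J 0 = J 1"
      by blast
    have row: "(\<Sum>j\<in>J c. ?b c k j) = c + (\<Sum>j\<in>J c - {k}. a k j)" for c
    proof -
      have "?b c k k = c"
        by (simp add: set_diagonal_def)
      moreover have "(\<Sum>j\<in>J c - {k}. ?b c k j) = (\<Sum>j\<in>J c - {k}. a k j)"
        by (intro sum.cong) (auto simp: set_diagonal_def)
      moreover have "(\<Sum>j\<in>J c. ?b c k j) = ?b c k k + (\<Sum>j\<in>J c - {k}. ?b c k j)"
        using fin new_col by (rule sum.remove)
      ultimately show ?thesis
        by (simp only:)
    qed
    have "0 + (\<Sum>j\<in>J 1 - {k}. a k j) = 1 + (\<Sum>j\<in>J 1 - {k}. a k j)"
      using row[of 0] row[of 1] zero[of k 0] zero[of k 1] same by simp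
    then show False
      by (simp only: add_right_cancel zero_neq_one)
  qed
qed

theorem proposition1p2:
  fixes n :: nat and M :: "bit mat"
  assumes "n \<ge> 1"
    and "M \<in> carrier_mat n n"
  shows "(\<exists>A \<in> carrier_mat n n. eq_off_diagonal M A \<and> degenerate A) \<and>
         (\<exists>B \<in> carrier_mat n n. eq_off_diagonal M B \<and> non_degenerate B)"
proof -
  let ?a = "\<lambda>i j. M $$ (i, j)"
  let ?A = "\<lambda>d. mat n n (\<lambda>(i, j). set_diagonal d ?a i j)"
  have A: "?A d \<in> carrier_mat n n" "eq_off_diagonal M (?A d)" for d
    using eq_off_diagonal_set_diagonal[OF assms(2)] by auto
  obtain d where d: "\<forall>i<n. (\<Sum>j<n. set_diagonal d ?a i j) = 0"
    using exists_diagonal_zero_row_sums by blast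
  have "0 \<in> {..<n}"
    using assms(1) by simp
  then have "degenerate (?A d)"
    using d unfolding degenerate_mat_iff independent_columns_def by blast
  moreover obtain e where "independent_columns n (set_diagonal e ?a)"
    using exists_diagonal_independent by blast
  then have "non_degenerate (?A e)"
    by (simp add: degenerate_mat_iff)
  ultimately show ?thesis
    using A by blast
qed

end
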